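(* The Grushin plane $\mathbb G$ equipped with its Carnot–Carathéodory distance $d_{cc}$ admits a bi-Lipschitz embedding into some Euclidean space $\mathbb R^n$.
   Context: The Grushin plane $\mathbb G$ is $\mathbb R^2$ with horizontal distribution spanned by $X_1=\partial_x$ and $X_2=x\,\partial_y$. A horizontal curve is an absolutely continuous $\gamma=(\mathrm x,\mathrm y):[0,1]\to\mathbb R^2$ with $\mathrm x'=a$, $\mathrm y'=\mathrm x\,b$ a.e. for measurable $a,b$; its length is $\int_0^1\sqrt{a^2+b^2}\,dt$. The Carnot–Carathéodory distance $d_{cc}(p,q)$ is the infimum of lengths of horizontal curves joining $p$ to $q$. *)

theory Defs
  imports "HOL-Analysis.Analysis"
begin

definition abs_continuous_on :: "real set \<Rightarrow> (real \<Rightarrow> real) \<Rightarrow> bool" where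
  "abs_continuous_on S f \<longleftrightarrow>
     (\<forall>e>0. \<exists>d>0. \<forall>(n::nat) (u::nat \<Rightarrow> real) (v::nat \<Rightarrow> real).
        (\<forall>i<n. u i \<le> v i \<and> u i \<in> S \<and> v i \<in> S) \<and>
        (\<forall>i<n. \<forall>j<n. i \<noteq> j \<longrightarrow> v i \<le> u j \<or> v j \<le> u i) \<and>
        (\<Sum>i<n. v i - u i) < d
        \<longrightarrow> (\<Sum>i<n. \<bar>f (v i) - f (u i)\<bar>) < e)"

definition grushin_horizontal ::
  "(real \<Rightarrow> real \<times> real) \<Rightarrow> (real \<Rightarrow> real) \<Rightarrow> (real \<Rightarrow> real) \<Rightarrow> bool" where
  "grushin_horizontal \<gamma> a b \<longleftrightarrow>
     abs_continuous_on {0..1} (\<lambda>t. fst (\<gamma> t)) \<and>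
     abs_continuous_on {0..1} (\<lambda>t. snd (\<gamma> t)) \<and>
     a \<in> borel_measurable lborel \<and> b \<in> borel_measurable lborel \<and>
     (AE t in lborel. t \<in> {0<..<1} \<longrightarrow>
        ((\<lambda>s. fst (\<gamma> s)) has_real_derivative a t) (at t) \<and>
        ((\<lambda>s. snd (\<gamma> s)) has_real_derivative fst (\<gamma> t) * b t) (at t))"

definition grushin_length :: "(real \<Rightarrow> real) \<Rightarrow> (real \<Rightarrow> real) \<Rightarrow> ennreal" where
  "grushin_length a b = (\<integral>\<^sup>+ t. ennreal (sqrt ((a t)\<^sup>2 + (b t)\<^sup>2)) * indicator {0..1} t \<partial>lborel)"

definition d_cc :: "real \<times> real \<Rightarrow> real \<times> real \<Rightarrow> ennreal" where
  "d_cc p q = (INF (\<gamma>, a, b) \<in> {(\<gamma>, a, b). grushin_horizontal \<gamma> a b \<and> \<gamma> 0 = p \<and> \<gamma> 1 = q}.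
                  grushin_length a b)"

text \<open>Euclidean distance in R^n, points represented as functions nat => real restricted to {..<n}.\<close>
definition eucl_dist :: "nat \<Rightarrow> (nat \<Rightarrow> real) \<Rightarrow> (nat \<Rightarrow> real) \<Rightarrow> real" where
  "eucl_dist n u v = sqrt (\<Sum>i<n. (u i - v i)\<^sup>2)"

end

theory Submission
  imports Defs
begin

text \<open>
  The distance between \<open>(x1, y1)\<close> and \<open>(x2, y2)\<close> is comparable to
  \<open>\<bar>x1 - x2\<bar> + \<bar>y1 - y2\<bar> / (\<bar>x2\<bar> + sqrt \<bar>y1 - y2\<bar>)\<close>. From below, a horizontal curve of
  length \<open>l\<close> stays in the strip of abscissae at most \<open>\<bar>x2\<bar> + l\<close>, so its height changes by at most
  \<open>(\<bar>x2\<bar> + l) * l\<close>. From above, a suitable curve with quadratic first coordinate and constant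
  \<open>b\<close> attains this order of length.

  The embedding is an Assouad-type series with a cutoff that depends on \<open>x\<close>. At scale
  \<open>q = 2 powi k\<close> the circle-valued function \<open>cis (q^2 * y) / q\<close> is used, switched off where
  \<open>\<bar>x\<bar>\<close> exceeds \<open>2 / q\<close>: there the coarser scales already embed the metric, which is nearly
  Euclidean at that resolution. Given two points of equal abscissa, one scale sees their distance
  and the others decay geometrically away from it; distributing the scales over ten residue
  classes of \<open>k\<close> makes the dominant scale visible in one of the resulting series. The coordinate
  \<open>x\<close> itself takes care of the horizontal part.
\<close>

section \<open>The fundamental theorem of calculus for absolutely continuous functions\<close>

text \<open>The definition indexes its intervals by \<open>{..<n}\<close>. A bijection from
  \<open>{..<card I}\<close> carries it over to any finite index set, later a set of tagged
  cells.\<close>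

lemma abs_continuous_on_finite_family:
  assumes "abs_continuous_on S f" "e > 0"
  shows "\<exists>d>0. \<forall>(I::'i set) u v. finite I \<longrightarrow> (\<forall>i\<in>I. u i \<le> v i \<and> u i \<in> S \<and> v i \<in> S) \<longrightarrow>
       (\<forall>i\<in>I. \<forall>j\<in>I. i \<noteq> j \<longrightarrow> v i \<le> u j \<or> v j \<le> u i) \<longrightarrow>
       (\<Sum>i\<in>I. v i - u i) < d \<longrightarrow> (\<Sum>i\<in>I. \<bar>f (v i) - f (u i)\<bar>) < e"
proof -
  obtain d where "d > 0" and d: "\<forall>(n::nat) u v.
      (\<forall>i<n. u i \<le> v i \<and> u i \<in> S \<and> v i \<in> S) \<and>
      (\<forall>i<n. \<forall>j<n. i \<noteq> j \<longrightarrow> v i \<le> u j \<or> v j \<le> u i) \<and>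
      (\<Sum>i<n. v i - u i) < d \<longrightarrow> (\<Sum>i<n. \<bar>f (v i) - f (u i)\<bar>) < e"
    using assms unfolding abs_continuous_on_def by blast
  show ?thesis
  proof (intro exI[of _ d] conjI allI impI \<open>d > 0\<close>)
    fix I :: "'i set" and u v :: "'i \<Rightarrow> real"
    assume I: "finite I" and uv: "\<forall>i\<in>I. u i \<le> v i \<and> u i \<in> S \<and> v i \<in> S"
      and disj: "\<forall>i\<in>I. \<forall>j\<in>I. i \<noteq> j \<longrightarrow> v i \<le> u j \<or> v j \<le> u i"
      and len: "(\<Sum>i\<in>I. v i - u i) < d"
    obtain h where h: "bij_betw h {..<card I} I"
      using ex_bij_betw_nat_finite[OF I] by (auto simp: atLeast0LessThan)
    have inI: "h i \<in> I" if "i < card I" for i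
      using h that by (auto simp: bij_betw_def)
    have inj: "h i \<noteq> h j" if "i < card I" "j < card I" "i \<noteq> j" for i j
      using h that by (auto simp: bij_betw_def inj_on_def)
    have "(\<Sum>i<card I. \<bar>f (v (h i)) - f (u (h i))\<bar>) < e"
    proof (rule d[rule_format], intro conjI)
      show "(\<Sum>i<card I. v (h i) - u (h i)) < d"
        using len sum.reindex_bij_betw[OF h, of "\<lambda>i. v i - u i"] by simp
      show "\<forall>i<card I. \<forall>j<card I. i \<noteq> j \<longrightarrow> v (h i) \<le> u (h j) \<or> v (h j) \<le> u (h i)"
        using disj inI inj by metis
    qed (use uv inI in blast)
    then show "(\<Sum>i\<in>I. \<bar>f (v i) - f (u i)\<bar>) < e"
      using sum.reindex_bij_betw[OF h, of "\<lambda>i. \<bar>f (v i) - f (u i)\<bar>"] by simp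
  qed
qed

text \<open>
  Henstock--Kurzweil sums make this short: tags outside \<open>N\<close> are controlled by the derivative,
  tags in \<open>N\<close> by absolute continuity, because the gauge keeps their intervals inside an open
  set of small measure.
\<close>
lemma has_integral_derivative_abs_continuous:
  fixes f g :: "real \<Rightarrow> real"
  assumes ac: "abs_continuous_on S f" and sub: "{a..b} \<subseteq> S" and ab: "a \<le> b"
    and N: "negligible N"
    and der: "\<And>t. t \<in> {a..b} - N \<Longrightarrow> (f has_real_derivative g t) (at t)"
  shows "(g has_integral f b - f a) {a..b}"
proof -
  \<comment> \<open>Zeroing the integrand on \<open>N\<close> leaves the integral unchanged, and a
    cell tagged in \<open>N\<close> then contributes only its increment of \<open>f\<close> to the
    error.\<close>
  define g' where "g' t = (if t \<in> N then 0 else g t)" for t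
  have "(g' has_integral f b - f a) {a..b}"
    unfolding has_integral_real
  proof (intro allI impI)
    fix e :: real assume "e > 0"
    \<comment> \<open>The summand 1 keeps the denominator positive when
      \<open>a = b\<close>.\<close>
    define e' where "e' = e / (2 * (b - a + 1))"
    have "e' > 0" using \<open>e > 0\<close> ab by (simp add: e'_def)
    obtain d where "d > 0" and d: "\<forall>(I::(real \<times> real set) set) u v. finite I \<longrightarrow>
       (\<forall>i\<in>I. u i \<le> v i \<and> u i \<in> S \<and> v i \<in> S) \<longrightarrow>
       (\<forall>i\<in>I. \<forall>j\<in>I. i \<noteq> j \<longrightarrow> v i \<le> u j \<or> v j \<le> u i) \<longrightarrow>
       (\<Sum>i\<in>I. v i - u i) < d \<longrightarrow> (\<Sum>i\<in>I. \<bar>f (v i) - f (u i)\<bar>) < e/2"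
      using abs_continuous_on_finite_family[OF ac half_gt_zero[OF \<open>e > 0\<close>]] by blast
    have Nnull: "N \<in> null_sets lebesgue"
      using N by (simp add: negligible_iff_null_sets)
    then obtain U where U: "open U" "N \<subseteq> U" "U - N \<in> lmeasurable" "emeasure lebesgue (U - N) < ennreal d"
      using sets_lebesgue_outer_open[of N d] \<open>d > 0\<close> by auto
    have Um: "U \<in> lmeasurable"
    proof -
      have "U = (U - N) \<union> N" using U by auto
      moreover have "N \<in> lmeasurable" using N by (simp add: negligible_imp_measurable)
      ultimately show ?thesis using U(3) fmeasurable.Un by metis
    qed
    have Ud: "measure lebesgue U < d"
    proof -
      have "emeasure lebesgue U < ennreal d"
        using U(4) emeasure_Diff_null_set[OF Nnull] Um by (simp add: fmeasurableD)
      then show ?thesis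
        using Um \<open>d > 0\<close> by (simp add: emeasure_eq_measure2 ennreal_less_iff)
    qed
    have "\<exists>r>0. (t \<in> N \<longrightarrow> ball t r \<subseteq> U) \<and>
        (t \<in> {a..b} - N \<longrightarrow> (\<forall>s. \<bar>s - t\<bar> < r \<longrightarrow> \<bar>f s - f t - g t * (s - t)\<bar> \<le> e' * \<bar>s - t\<bar>))" for t
    proof (cases "t \<in> N")
      case True
      then obtain r where "r > 0" "ball t r \<subseteq> U" using U open_contains_ball by blast
      with True show ?thesis by auto
    next
      case False
      show ?thesis
      proof (cases "t \<in> {a..b}")
        case True
        then have "(f has_derivative (\<lambda>h. g t * h)) (at t)"
          using der False by (auto simp: has_field_derivative_def)
        then show ?thesis using \<open>e' > 0\<close> False
          unfolding has_derivative_at_alt by auto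
      qed (use False in \<open>auto intro: exI[of _ 1]\<close>)
    qed
    then obtain r where r: "\<And>t. r t > 0" "\<And>t. t \<in> N \<Longrightarrow> ball t (r t) \<subseteq> U"
      "\<And>t s. t \<in> {a..b} - N \<Longrightarrow> \<bar>s - t\<bar> < r t \<Longrightarrow> \<bar>f s - f t - g t * (s - t)\<bar> \<le> e' * \<bar>s - t\<bar>"
      by metis
    show "\<exists>\<gamma>. gauge \<gamma> \<and> (\<forall>\<D>. \<D> tagged_division_of {a..b} \<and> \<gamma> fine \<D> \<longrightarrow>
        norm ((\<Sum>(x, k)\<in>\<D>. measure lborel k *\<^sub>R g' x) - (f b - f a)) < e)"
    proof (intro exI conjI allI impI; (elim conjE)?)
      show "gauge (\<lambda>t. ball t (r t))" using r(1) by (auto intro: gauge_ball_dependent)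
    next
      fix D assume D: "D tagged_division_of {a..b}" and fine: "(\<lambda>t. ball t (r t)) fine D"
      note Dd = tagged_division_ofD[OF D]
      have cell: "K = {Inf K..Sup K} \<and> Inf K \<le> t \<and> t \<le> Sup K \<and> a \<le> Inf K \<and> Sup K \<le> b \<and>
          measure lborel K = Sup K - Inf K \<and> K \<subseteq> ball t (r t)" if tK: "(t, K) \<in> D" for t K
      proof -
        obtain u v where uv: "K = {u..v}" using Dd(4)[OF tK] by (auto simp: box_real)
        have "t \<in> K" "K \<subseteq> {a..b}" using Dd(2,3)[OF tK] by auto
        moreover have "K \<subseteq> ball t (r t)" using fine tK by (auto simp: fine_def)
        ultimately show ?thesis using uv by auto
      qed
      \<comment> \<open>Degenerate cells are left out: they have zero increment, and without them
        \<open>snd\<close> is injective on \<open>B\<close> and distinct cells lie on either side of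
        each other.\<close>
      define B where "B = {(t, K) \<in> D. t \<in> N \<and> interior K \<noteq> {}}"
      have "B \<subseteq> D" by (auto simp: B_def)
      then have finB: "finite B" using Dd(1) finite_subset by blast
      have lenB: "(\<Sum>i\<in>B. Sup (snd i) - Inf (snd i)) < d"
      proof -
        have tp: "B tagged_partial_division_of {a..b}"
          using D \<open>B \<subseteq> D\<close> tagged_partial_division_subset tagged_division_of_def by metis
        have div: "(snd ` B) division_of \<Union>(snd ` B)"
          using division_of_tagged_division[OF tagged_partial_division_of_Union_self[OF tp]] .
        have "inj_on snd B"
        proof (rule inj_onI)
          fix i j assume ij: "i \<in> B" "j \<in> B" "snd i = snd j"
          then show "i = j"
            using Dd(5)[of "fst i" "snd i" "fst j" "snd j"] by (cases i; cases j) (auto simp: B_def)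
        qed
        moreover have "measure lebesgue (snd i) = Sup (snd i) - Inf (snd i)" if "i \<in> B" for i
        proof -
          have "(fst i, snd i) \<in> D" using that \<open>B \<subseteq> D\<close> by auto
          note c = cell[OF this]
          then have "snd i \<in> sets borel" by (metis atLeastAtMost_borel)
          with c show ?thesis by (simp add: measure_completion)
        qed
        ultimately have "(\<Sum>i\<in>B. Sup (snd i) - Inf (snd i)) = (\<Sum>K\<in>snd ` B. measure lebesgue K)"
          by (simp add: sum.reindex)
        also have "\<dots> = measure lebesgue (\<Union>(snd ` B))"
          using content_division[OF div] .
        also have "\<dots> \<le> measure lebesgue U"
        proof (rule measure_mono_fmeasurable)
          show "\<Union>(snd ` B) \<subseteq> U" using cell r(2) by (fastforce simp: B_def)
          show "\<Union>(snd ` B) \<in> sets lebesgue" using lmeasurable_division[OF div] by auto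
        qed (use Um in auto)
        finally show ?thesis using Ud by simp
      qed
      have ACB: "(\<Sum>i\<in>B. \<bar>f (Sup (snd i)) - f (Inf (snd i))\<bar>) < e/2"
      proof (rule d[rule_format, OF finB _ _ lenB])
        fix i assume "i \<in> B"
        then have "(fst i, snd i) \<in> D" using \<open>B \<subseteq> D\<close> by auto
        from cell[OF this] show "Inf (snd i) \<le> Sup (snd i) \<and> Inf (snd i) \<in> S \<and> Sup (snd i) \<in> S"
          using sub by auto
      next
        fix i j assume ij: "i \<in> B" "j \<in> B" "i \<noteq> j"
        obtain s K t L where e: "i = (s, K)" "j = (t, L)" by (cases i; cases j) auto
        have KD: "(s, K) \<in> D" "(t, L) \<in> D" "interior K \<noteq> {}" "interior L \<noteq> {}"
          using ij e by (auto simp: B_def)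
        have iK: "interior K = {Inf K<..<Sup K}" "interior L = {Inf L<..<Sup L}"
          using cell[OF KD(1)] cell[OF KD(2)] interior_atLeastAtMost_real by metis+
        have "interior K \<inter> interior L = {}"
          using Dd(5)[OF KD(1,2)] ij e by auto
        then have disj: "{Inf K<..<Sup K} \<inter> {Inf L<..<Sup L} = {}" unfolding iK .
        have "Inf K < Sup K" "Inf L < Sup L" using KD(3,4) unfolding iK by auto
        then have "Sup K \<le> Inf L \<or> Sup L \<le> Inf K"
        proof -
          { assume "\<not> (Sup K \<le> Inf L \<or> Sup L \<le> Inf K)"
            then have "max (Inf K) (Inf L) < min (Sup K) (Sup L)"
              using \<open>Inf K < Sup K\<close> \<open>Inf L < Sup L\<close> by auto
            then obtain z where "max (Inf K) (Inf L) < z" "z < min (Sup K) (Sup L)"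
              using dense by blast
            then have False using disj by auto }
          then show ?thesis by blast
        qed
        then show "Sup (snd i) \<le> Inf (snd j) \<or> Sup (snd j) \<le> Inf (snd i)" by (simp add: e)
      qed
      define \<Delta> where "\<Delta> i = f (Sup (snd i)) - f (Inf (snd i))" for i :: "real \<times> real set"
      have bound: "\<bar>measure lborel (snd i) * g' (fst i) - \<Delta> i\<bar>
          \<le> e' * measure lborel (snd i) + (if i \<in> B then \<bar>\<Delta> i\<bar> else 0)" if "i \<in> D" for i
      proof -
        obtain t K where i: "i = (t, K)" by (cases i)
        note c = cell[OF that[unfolded i]]
        show ?thesis
        proof (cases "t \<in> N")
          case True
          have "\<Delta> i = 0" if "i \<notin> B"
          proof -
            have "interior K = {}" using that True \<open>i \<in> D\<close> i by (auto simp: B_def)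
            then have "{Inf K<..<Sup K} = {}" using c interior_atLeastAtMost_real by metis
            then have "Inf K = Sup K" using c by auto
            then show ?thesis by (simp add: \<Delta>_def i)
          qed
          then show ?thesis using True \<open>e' > 0\<close> by (auto simp: i g'_def)
        next
          case False
          have cK: "measure lborel K = Sup K - Inf K" using c by blast
          have t: "t \<in> {a..b} - N" using c False by auto
          have "Inf K \<in> K" "Sup K \<in> K" using c by (metis atLeastAtMost_iff order.trans order_refl)+
          then have "Inf K \<in> ball t (r t)" "Sup K \<in> ball t (r t)" using c by blast+
          then have "\<bar>Inf K - t\<bar> < r t" "\<bar>Sup K - t\<bar> < r t" by (auto simp: dist_real_def)
          then have 1: "\<bar>f (Inf K) - f t - g t * (Inf K - t)\<bar> \<le> e' * (t - Inf K)"
            and 2: "\<bar>f (Sup K) - f t - g t * (Sup K - t)\<bar> \<le> e' * (Sup K - t)"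
            using r(3)[OF t] c by fastforce+
          \<comment> \<open>Straddling the tag: the error of the cell is the difference of the
            linearization errors at its two ends, whose bounds add up to the length of the cell
            times \<open>e'\<close>.\<close>
          have "measure lborel K * g' t - \<Delta> i = (f (Inf K) - f t - g t * (Inf K - t)) - (f (Sup K) - f t - g t * (Sup K - t))"
            using False unfolding cK by (simp add: g'_def \<Delta>_def i algebra_simps)
          then have "\<bar>measure lborel K * g' t - \<Delta> i\<bar> \<le> e' * (t - Inf K) + e' * (Sup K - t)"
            using 1 2 by linarith
          also have "\<dots> = e' * measure lborel K" unfolding cK by (simp add: algebra_simps)
          finally show ?thesis by (auto simp: i)
        qed
      qed
      have sumC: "(\<Sum>i\<in>D. measure lborel (snd i)) = b - a"
        using additive_content_tagged_division[of D a b] D ab by (simp add: box_real split_def)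
      have sumD: "(\<Sum>i\<in>D. \<Delta> i) = f b - f a"
        using additive_tagged_division_1[OF ab D, of f] by (simp add: \<Delta>_def split_def)
      have "norm ((\<Sum>(x, k)\<in>D. measure lborel k *\<^sub>R g' x) - (f b - f a))
          = \<bar>\<Sum>i\<in>D. measure lborel (snd i) * g' (fst i) - \<Delta> i\<bar>"
        by (simp add: sumD[symmetric] sum_subtractf split_def)
      also have "\<dots> \<le> (\<Sum>i\<in>D. e' * measure lborel (snd i) + (if i \<in> B then \<bar>\<Delta> i\<bar> else 0))"
        by (rule order_trans[OF sum_abs]) (rule sum_mono, rule bound)
      also have "\<dots> = e' * (b - a) + (\<Sum>i\<in>B. \<bar>\<Delta> i\<bar>)"
        using Dd(1) \<open>B \<subseteq> D\<close>
        by (simp add: sum.distrib sum_distrib_left[symmetric] sumC sum.If_cases Int_absorb1)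
      also have "\<dots> < e/2 + e/2"
      proof (rule add_le_less_mono)
        have "e' * (b - a) \<le> e' * (b - a + 1)" using \<open>e' > 0\<close> by simp
        also have "\<dots> = e/2" using ab by (simp add: e'_def field_simps)
        finally show "e' * (b - a) \<le> e/2" .
      qed (use ACB in \<open>simp add: \<Delta>_def\<close>)
      finally show "norm ((\<Sum>(x, k)\<in>D. measure lborel k *\<^sub>R g' x) - (f b - f a)) < e" by simp
    qed
  qed
  then show ?thesis
    by (rule has_integral_spike[OF N, rotated]) (auto simp: g'_def)
qed

section \<open>Comparison of the distance with an explicit gauge\<close>

text \<open>
  At \<open>x = t = 0\<close> the quotient is \<open>0 / 0 = 0\<close>, which is the intended value.
\<close>
definition vert :: "real \<Rightarrow> real \<Rightarrow> real" where
  "vert x t = \<bar>t\<bar> / (\<bar>x\<bar> + sqrt \<bar>t\<bar>)"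

text \<open>
  Up to constants this is the distance. Only the second endpoint enters the vertical part: a bound
  \<open>\<bar>y1 - y2\<bar> \<le> (\<bar>x\<bar> + l) * l\<close> holds with the abscissa \<open>x\<close> of either endpoint.
\<close>
definition grushin_gauge :: "real \<times> real \<Rightarrow> real \<times> real \<Rightarrow> real" where
  "grushin_gauge p q = \<bar>fst p - fst q\<bar> + vert (fst q) (snd p - snd q)"

lemma vert_nonneg: "0 \<le> vert x t"
  by (simp add: vert_def)

lemma abs_continuous_on_Lipschitz:
  assumes "\<And>s t. s \<in> S \<Longrightarrow> t \<in> S \<Longrightarrow> \<bar>f s - f t\<bar> \<le> L * \<bar>s - t\<bar>"
  shows "abs_continuous_on S f"
  unfolding abs_continuous_on_def
proof (intro allI impI)
  fix e :: real assume "e > 0"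
  define d where "d = e / (\<bar>L\<bar> + 1)"
  show "\<exists>d>0. \<forall>(n::nat) (u::nat \<Rightarrow> real) (v::nat \<Rightarrow> real).
        (\<forall>i<n. u i \<le> v i \<and> u i \<in> S \<and> v i \<in> S) \<and>
        (\<forall>i<n. \<forall>j<n. i \<noteq> j \<longrightarrow> v i \<le> u j \<or> v j \<le> u i) \<and>
        (\<Sum>i<n. v i - u i) < d
        \<longrightarrow> (\<Sum>i<n. \<bar>f (v i) - f (u i)\<bar>) < e"
  proof (intro exI[of _ d] conjI allI impI; (elim conjE)?)
    show "d > 0" using \<open>e > 0\<close> by (simp add: d_def)
    fix n :: nat and u v :: "nat \<Rightarrow> real"
    assume uv: "\<forall>i<n. u i \<le> v i \<and> u i \<in> S \<and> v i \<in> S" and len: "(\<Sum>i<n. v i - u i) < d"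
    have "(\<Sum>i<n. \<bar>f (v i) - f (u i)\<bar>) \<le> (\<Sum>i<n. (\<bar>L\<bar> + 1) * (v i - u i))"
    proof (rule sum_mono)
      fix i assume "i \<in> {..<n}"
      then have i: "u i \<le> v i" "u i \<in> S" "v i \<in> S" using uv by auto
      have "\<bar>f (v i) - f (u i)\<bar> \<le> L * (v i - u i)" using assms[OF i(3,2)] i(1) by simp
      also have "\<dots> \<le> (\<bar>L\<bar> + 1) * (v i - u i)" using i(1) by (intro mult_right_mono) auto
      finally show "\<bar>f (v i) - f (u i)\<bar> \<le> (\<bar>L\<bar> + 1) * (v i - u i)" .
    qed
    also have "\<dots> = (\<bar>L\<bar> + 1) * (\<Sum>i<n. v i - u i)" by (simp add: sum_distrib_left)
    also have "\<dots> < (\<bar>L\<bar> + 1) * d" using len by (intro mult_strict_left_mono) auto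
    also have "\<dots> = e" by (simp add: d_def)
    finally show "(\<Sum>i<n. \<bar>f (v i) - f (u i)\<bar>) < e" .
  qed
qed

lemma abs_continuous_on_bounded_deriv:
  assumes "\<And>t. t \<in> {0..1} \<Longrightarrow> (f has_real_derivative f' t) (at t)"
    and "\<And>t. t \<in> {0..1} \<Longrightarrow> \<bar>f' t\<bar> \<le> L"
  shows "abs_continuous_on {0..1} f"
proof (rule abs_continuous_on_Lipschitz)
  fix s t :: real assume st: "s \<in> {0..1}" "t \<in> {0..1}"
  have "norm (f s - f t) \<le> L * norm (s - t)"
    by (rule field_differentiable_bound[of "{0..1}" f f'])
      (use assms st in \<open>auto intro: has_field_derivative_at_within\<close>)
  then show "\<bar>f s - f t\<bar> \<le> L * \<bar>s - t\<bar>" by simp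
qed

text \<open>The speed dominates both \<open>\<bar>a\<bar>\<close> and \<open>\<bar>b\<bar>\<close>.
  Integrating \<open>a\<close> confines the curve to a strip of abscissae, and there
  \<open>\<bar>y'\<bar>\<close> is at most the width of the strip times the speed.\<close>

lemma horizontal_displacement:
  assumes hor: "grushin_horizontal \<gamma> a b" and len: "grushin_length a b = ennreal l" and "l \<ge> 0"
  shows "\<bar>fst (\<gamma> 0) - fst (\<gamma> 1)\<bar> \<le> l"
    and "\<bar>snd (\<gamma> 0) - snd (\<gamma> 1)\<bar> \<le> (\<bar>fst (\<gamma> 1)\<bar> + l) * l"
proof -
  define x where "x t = fst (\<gamma> t)" for t
  define y where "y t = snd (\<gamma> t)" for t
  define c where "c t = sqrt ((a t)\<^sup>2 + (b t)\<^sup>2)" for t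
  have acx: "abs_continuous_on {0..1} x" and acy: "abs_continuous_on {0..1} y"
    and meas [measurable]: "a \<in> borel_measurable borel" "b \<in> borel_measurable borel"
    and ae: "AE t in lborel. t \<in> {0<..<1} \<longrightarrow>
        (x has_real_derivative a t) (at t) \<and> (y has_real_derivative x t * b t) (at t)"
    using hor by (auto simp: grushin_horizontal_def x_def[abs_def] y_def[abs_def])
  have ca: "\<bar>a t\<bar> \<le> c t" and cb: "\<bar>b t\<bar> \<le> c t" and c0: "0 \<le> c t" for t
    by (auto simp: c_def)
  obtain N0 where N0: "N0 \<in> null_sets lborel" and N0_sub: "{t \<in> space lborel. \<not> (t \<in> {0<..<1} \<longrightarrow>
        (x has_real_derivative a t) (at t) \<and> (y has_real_derivative x t * b t) (at t))} \<subseteq> N0"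
    using ae unfolding eventually_ae_filter by (elim bexE) (rule that)
  \<comment> \<open>Derivatives are given only inside the open interval, so the endpoints join the
    exceptional set.\<close>
  define N where "N = N0 \<union> {0, 1}"
  have N: "negligible N"
    unfolding N_def using N0
    by (intro negligible_Un) (auto simp: negligible_iff_null_sets null_sets_completionI)
  have der: "(x has_real_derivative a t) (at t)" "(y has_real_derivative x t * b t) (at t)"
    if "t \<in> {0..1} - N" for t
    using subsetD[OF N0_sub, of t] that by (auto simp: N_def less_le)
  have "((\<lambda>t. c t * indicator {0..1} t) has_integral l) UNIV"
  proof (rule nn_integral_has_integral)
    show "(\<integral>\<^sup>+ t. ennreal (c t * indicator {0..1} t) \<partial>lborel) = ennreal l"
      using len unfolding grushin_length_def c_def
      by (subst (asm) nn_integral_cong[where v = "\<lambda>t. ennreal (sqrt ((a t)\<^sup>2 + (b t)\<^sup>2) * indicator {0..1} t)"])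
        (auto split: split_indicator)
  qed (use c0 \<open>l \<ge> 0\<close> in \<open>auto simp: c_def\<close>)
  moreover have "(\<lambda>t. c t * indicator {0..1} t) = (\<lambda>t. if t \<in> {0..1} then c t else 0)"
    by (auto split: split_indicator)
  ultimately have ci: "(c has_integral l) {0..1}"
    by (simp only: has_integral_restrict_UNIV)
  \<comment> \<open>Integrating over \<open>{t..1}\<close> measures the strip from the second
    endpoint, the one that \<open>grushin_gauge\<close> uses.\<close>
  have xt: "\<bar>x 1 - x t\<bar> \<le> l" if t: "t \<in> {0..1}" for t
  proof -
    have a: "(a has_integral x 1 - x t) {t..1}"
      by (rule has_integral_derivative_abs_continuous[OF acx _ _ N]) (use t der in auto)
    have ct: "c integrable_on {t..1}"
      using integrable_on_subinterval[of c "{0..1}" t 1] ci t by (auto simp: integrable_on_def)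
    have "norm (integral {t..1} a) \<le> integral {t..1} c"
      by (rule integral_norm_bound_integral) (use a ct ca in \<open>auto simp: integrable_on_def\<close>)
    also have "\<dots> \<le> integral {0..1} c"
      by (rule integral_subset_le) (use t ct ci c0 in \<open>auto simp: integrable_on_def\<close>)
    also have "\<dots> = l" using ci by (rule integral_unique)
    finally show ?thesis using a by (simp add: integral_unique)
  qed
  show "\<bar>fst (\<gamma> 0) - fst (\<gamma> 1)\<bar> \<le> l"
    using xt[of 0] by (simp add: x_def abs_minus_commute)
  have yi: "((\<lambda>t. x t * b t) has_integral y 1 - y 0) {0..1}"
    by (rule has_integral_derivative_abs_continuous[OF acy _ _ N]) (use der in auto)
  have ci': "((\<lambda>t. (\<bar>x 1\<bar> + l) * c t) has_integral (\<bar>x 1\<bar> + l) * l) {0..1}"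
    by (rule has_integral_mult_right[OF ci])
  have "norm (integral {0..1} (\<lambda>t. x t * b t)) \<le> integral {0..1} (\<lambda>t. (\<bar>x 1\<bar> + l) * c t)"
  proof (rule integral_norm_bound_integral)
    fix t :: real assume "t \<in> {0..1}"
    then have "\<bar>x t\<bar> \<le> \<bar>x 1\<bar> + l" using xt[of t] by linarith
    then show "norm (x t * b t) \<le> (\<bar>x 1\<bar> + l) * c t"
      unfolding real_norm_def abs_mult by (intro mult_mono cb) (use \<open>l \<ge> 0\<close> in auto)
  qed (use yi ci' in \<open>auto simp: integrable_on_def\<close>)
  then show "\<bar>snd (\<gamma> 0) - snd (\<gamma> 1)\<bar> \<le> (\<bar>fst (\<gamma> 1)\<bar> + l) * l"
    unfolding integral_unique[OF yi] integral_unique[OF ci'] by (simp add: x_def y_def abs_minus_commute)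
qed

text \<open>With \<open>s = sqrt \<bar>t\<bar>\<close> the claim reads
  \<open>s * s \<le> l * (\<bar>x\<bar> + s)\<close>. It is immediate for \<open>l \<ge> s\<close>;
  otherwise the \<open>l\<close> inside the bracket of the hypothesis may be raised to
  \<open>s\<close>.\<close>

lemma vert_le:
  assumes "\<bar>t\<bar> \<le> (\<bar>x\<bar> + l) * l" "l \<ge> 0"
  shows "vert x t \<le> l"
proof (cases "t = 0")
  case False
  define s where "s = sqrt \<bar>t\<bar>"
  have s: "s > 0" "\<bar>t\<bar> = s * s" using False by (auto simp: s_def)
  have "\<bar>t\<bar> \<le> l * (\<bar>x\<bar> + s)"
  proof (cases "l \<ge> s")
    case True
    then have "s * s \<le> l * s" using s by simp
    moreover have "0 \<le> l * \<bar>x\<bar>" using assms(2) by simp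
    ultimately show ?thesis unfolding s(2) distrib_left by linarith
  next
    case False
    have "\<bar>t\<bar> \<le> (\<bar>x\<bar> + l) * l" by fact
    also have "\<dots> \<le> (\<bar>x\<bar> + s) * l" using False assms(2) by (intro mult_right_mono) auto
    finally show ?thesis by (simp add: mult.commute)
  qed
  then show ?thesis using s by (simp add: vert_def s_def[symmetric] pos_divide_le_eq add_nonneg_pos)
qed (use assms in \<open>simp add: vert_def\<close>)

text \<open>Each of the two summands of the gauge is at most the length of any joining curve, hence
  the factor 2.\<close>

lemma grushin_gauge_le_d_cc: "ennreal (grushin_gauge p q) \<le> 2 * d_cc p q"
proof -
  have "ennreal (grushin_gauge p q / 2) \<le> d_cc p q"
    unfolding d_cc_def
  proof (rule INF_greatest, clarify)
    fix \<gamma> a b assume hor: "grushin_horizontal \<gamma> a b" and pq: "p = \<gamma> 0" "q = \<gamma> 1"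
    show "ennreal (grushin_gauge (\<gamma> 0) (\<gamma> 1) / 2) \<le> grushin_length a b"
    proof (cases "grushin_length a b")
      case (real l)
      note h = horizontal_displacement[OF hor real(2,1)]
      have "vert (fst (\<gamma> 1)) (snd (\<gamma> 0) - snd (\<gamma> 1)) \<le> l"
        using h(2) real(1) by (rule vert_le)
      then have "grushin_gauge (\<gamma> 0) (\<gamma> 1) / 2 \<le> l" using h(1) by (simp add: grushin_gauge_def)
      then show ?thesis using real by (simp add: ennreal_leI)
    qed simp
  qed
  then have "2 * ennreal (grushin_gauge p q / 2) \<le> 2 * d_cc p q"
    by (rule mult_left_mono) simp
  moreover have "2 * ennreal (grushin_gauge p q / 2) = ennreal (grushin_gauge p q)"
    using ennreal_mult'[of 2 "grushin_gauge p q / 2"] by simp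
  ultimately show ?thesis by simp
qed

text \<open>With constant \<open>b = \<beta>\<close> the height gained is \<open>\<beta>\<close>
  times the mean abscissa \<open>m\<close>. The bump \<open>h * (t - t\<^sup>2)\<close> pushes the
  curve away from the singular axis until \<open>\<bar>m\<bar>\<close> is at least half of
  \<open>\<bar>x2\<bar> + s\<close>, so that \<open>\<bar>\<beta>\<bar> \<le> 2 * D\<close>
  suffices.\<close>

lemma d_cc_le_grushin_gauge: "d_cc p q \<le> ennreal (9 * grushin_gauge p q)"
proof -
  obtain x1 y1 x2 y2 where pq: "p = (x1, y1)" "q = (x2, y2)" by (cases p; cases q)
  define D where "D = vert x2 (y1 - y2)"
  define \<sigma> :: real where "\<sigma> = (if x1 + x2 \<ge> 0 then 1 else -1)"
  define H where "H = \<bar>x1 - x2\<bar> + D"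
  \<comment> \<open>The mean of \<open>t - t\<^sup>2\<close> over the unit interval is
    \<open>1 / 6\<close>, so the bump adds exactly \<open>H\<close> to \<open>\<bar>m\<bar>\<close>;
    the sign \<open>\<sigma>\<close> prevents cancellation with \<open>x1 + x2\<close>.\<close>
  define h where "h = \<sigma> * (6 * H)"
  define m where "m = (x1 + x2) / 2 + h / 6"
  define \<beta> where "\<beta> = (y2 - y1) / m"
  define s where "s = sqrt \<bar>y1 - y2\<bar>"
  have D0: "D \<ge> 0" by (simp add: D_def vert_nonneg)
  have H0: "H \<ge> 0" using D0 by (simp add: H_def)
  have habs: "\<bar>h\<bar> = 6 * H" using H0 by (simp add: h_def \<sigma>_def abs_mult)
  have mabs: "\<bar>m\<bar> = \<bar>x1 + x2\<bar> / 2 + H"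
    using H0 by (auto simp: m_def h_def \<sigma>_def field_simps)
  have s0: "s \<ge> 0" "\<bar>y1 - y2\<bar> = s * s" by (auto simp: s_def)
  \<comment> \<open>This form of the definition of \<open>D\<close>, cleared of its denominator,
    also covers the case \<open>0 / 0\<close>.\<close>
  have Dw: "D * (\<bar>x2\<bar> + s) = s * s"
  proof (cases "\<bar>x2\<bar> + s = 0")
    case True
    then have "s = 0" using s0 by linarith
    with True show ?thesis by simp
  next
    case False
    moreover have "D = s * s / (\<bar>x2\<bar> + s)" unfolding D_def vert_def by (simp add: s_def)
    ultimately show ?thesis by simp
  qed
  have Ds: "\<bar>x2\<bar> + D \<ge> (\<bar>x2\<bar> + s) / 2"
  proof (cases "s \<le> \<bar>x2\<bar>")
    case False
    have "D \<ge> s / 2"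
    proof (rule ccontr)
      assume "\<not> D \<ge> s / 2"
      then have "D * (\<bar>x2\<bar> + s) < (s / 2) * (\<bar>x2\<bar> + s)"
        using False by (intro mult_strict_right_mono) auto
      also have "\<dots> \<le> (s / 2) * (2 * s)" using False s0 by (intro mult_left_mono) auto
      finally show False using Dw by simp
    qed
    then show ?thesis by (simp add: field_simps)
  qed (use D0 in auto)
  have mge: "\<bar>m\<bar> \<ge> (\<bar>x2\<bar> + s) / 2"
  proof -
    have "\<bar>x2\<bar> \<le> \<bar>x1 + x2\<bar> / 2 + \<bar>x1 - x2\<bar>" by (auto simp: abs_if field_simps)
    then show ?thesis unfolding mabs H_def using Ds by linarith
  qed
  \<comment> \<open>If \<open>m = 0\<close>, then \<open>mge\<close> forces \<open>s = 0\<close>, so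
    the two heights agree.\<close>
  have \<beta>m: "\<beta> * m = y2 - y1"
  proof (cases "m = 0")
    case True
    then have "s = 0" using mge s0 by simp
    with True show ?thesis using s0 by simp
  qed (simp add: \<beta>_def)
  have \<beta>le: "\<bar>\<beta>\<bar> \<le> 2 * D"
  proof (cases "m = 0")
    case False
    have "\<bar>y2 - y1\<bar> = s * s" using s0 by (simp add: abs_minus_commute)
    also have "\<dots> = 2 * D * ((\<bar>x2\<bar> + s) / 2)" using Dw by simp
    also have "\<dots> \<le> 2 * D * \<bar>m\<bar>" using mge D0 by (intro mult_left_mono) auto
    finally show ?thesis using False by (simp add: \<beta>_def pos_divide_le_eq abs_divide)
  qed (use D0 in \<open>simp add: \<beta>_def\<close>)
  define x where "x t = x1 + t * (x2 - x1) + h * (t - t\<^sup>2)" for t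
  define y where "y t = y1 + \<beta> * (x1 * t + (x2 - x1) * t\<^sup>2 / 2 + h * (t\<^sup>2 / 2 - t ^ 3 / 3))" for t
  define a where "a t = (x2 - x1) + h * (1 - 2 * t)" for t
  have dx: "(x has_real_derivative a t) (at t)" for t
    unfolding x_def a_def by (auto intro!: derivative_eq_intros simp: algebra_simps)
  have dy: "(y has_real_derivative x t * \<beta>) (at t)" for t
    unfolding x_def y_def by (auto intro!: derivative_eq_intros simp: field_simps power2_eq_square)
  have abound: "\<bar>a t\<bar> \<le> \<bar>x1 - x2\<bar> + 6 * H" if "t \<in> {0..1}" for t
  proof -
    have "\<bar>h * (1 - 2 * t)\<bar> \<le> \<bar>h\<bar> * 1"
      unfolding abs_mult by (rule mult_left_mono) (use that in auto)
    then show ?thesis unfolding a_def habs by linarith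
  qed
  have xbound: "\<bar>x t * \<beta>\<bar> \<le> (\<bar>x1\<bar> + \<bar>x2 - x1\<bar> + \<bar>h\<bar>) * \<bar>\<beta>\<bar>" if "t \<in> {0..1}" for t
  proof -
    have "t\<^sup>2 \<le> t" using that by (simp add: power2_eq_square mult_left_le)
    moreover have "0 \<le> t\<^sup>2" by simp
    ultimately have "\<bar>t - t\<^sup>2\<bar> \<le> 1" using that unfolding atLeastAtMost_iff by linarith
    then have "\<bar>h * (t - t\<^sup>2)\<bar> \<le> \<bar>h\<bar> * 1" unfolding abs_mult by (rule mult_left_mono) simp
    moreover have "\<bar>t * (x2 - x1)\<bar> \<le> 1 * \<bar>x2 - x1\<bar>" unfolding abs_mult
      by (rule mult_right_mono) (use that in auto)
    ultimately have "\<bar>x t\<bar> \<le> \<bar>x1\<bar> + \<bar>x2 - x1\<bar> + \<bar>h\<bar>"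
      unfolding x_def
      using abs_triangle_ineq[of "x1 + t * (x2 - x1)" "h * (t - t\<^sup>2)"]
        abs_triangle_ineq[of x1 "t * (x2 - x1)"]
      by simp
    then show ?thesis unfolding abs_mult by (rule mult_right_mono) simp
  qed
  have hor: "grushin_horizontal (\<lambda>t. (x t, y t)) a (\<lambda>_. \<beta>)"
    unfolding grushin_horizontal_def
    using abs_continuous_on_bounded_deriv[OF dx abound] abs_continuous_on_bounded_deriv[OF dy xbound] dx dy
    by (auto simp: a_def[abs_def])
  have ends: "(x 0, y 0) = p" "(x 1, y 1) = q"
  proof -
    have "y 1 = y1 + \<beta> * m" by (simp add: y_def m_def field_simps)
    then show "(x 1, y 1) = q" using \<beta>m by (simp add: pq x_def)
  qed (simp add: pq x_def y_def)
  have "d_cc p q \<le> grushin_length a (\<lambda>_. \<beta>)"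
    unfolding d_cc_def using hor ends
    by (intro INF_lower2[of "(\<lambda>t. (x t, y t), a, \<lambda>_. \<beta>)"]) auto
  also have "\<dots> \<le> (\<integral>\<^sup>+ t. ennreal (9 * grushin_gauge p q) * indicator {0..1} (t::real) \<partial>lborel)"
    unfolding grushin_length_def
  proof (rule nn_integral_mono)
    fix t :: real
    have "sqrt ((a t)\<^sup>2 + \<beta>\<^sup>2) \<le> 9 * grushin_gauge p q" if "t \<in> {0..1}"
    proof -
      have "sqrt ((a t)\<^sup>2 + \<beta>\<^sup>2) \<le> \<bar>a t\<bar> + \<bar>\<beta>\<bar>" by (rule sqrt_sum_squares_le_sum_abs)
      also have "\<dots> \<le> \<bar>x1 - x2\<bar> + 6 * H + 2 * D" using abound[OF that] \<beta>le by linarith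
      also have "\<dots> \<le> 9 * grushin_gauge p q"
        using D0 by (simp add: H_def grushin_gauge_def pq D_def)
      finally show ?thesis .
    qed
    then show "ennreal (sqrt ((a t)\<^sup>2 + \<beta>\<^sup>2)) * indicator {0..1} t
        \<le> ennreal (9 * grushin_gauge p q) * indicator {0..1} t"
      by (auto split: split_indicator intro: ennreal_leI)
  qed
  also have "\<dots> = ennreal (9 * grushin_gauge p q)"
    by (simp add: nn_integral_cmult_indicator)
  finally show ?thesis .
qed

section \<open>The lacunary series\<close>

text \<open>A plateau of height \<open>1 / q\<close> for \<open>\<bar>x\<bar> \<le> 1 / q\<close>,
  descending with slope 1 to zero at \<open>2 / q\<close>. The amplitude \<open>1 / q\<close> of the
  wave is thus built in.\<close>

definition cutoff :: "real \<Rightarrow> real \<Rightarrow> real" where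
  "cutoff q x = 2 / q - max (1 / q) (min (2 / q) \<bar>x\<bar>)"

text \<open>
  Subtracting 1 makes every wave vanish at the origin, so that the Lipschitz estimate for the
  series at \<open>(p, (0, 0))\<close> already contains its convergence.
\<close>
definition wave :: "real \<Rightarrow> real \<times> real \<Rightarrow> complex" where
  "wave q p = complex_of_real (cutoff q (fst p)) * (cis (q\<^sup>2 * snd p) - 1)"

text \<open>Consecutive scales in one residue class differ by the factor \<open>2 ^ 10\<close>; this
  gap lets a dominant term outweigh the rest of its series.\<close>

definition wave_sum :: "nat \<Rightarrow> real \<times> real \<Rightarrow> complex" where
  "wave_sum j p = (\<Sum>\<^sub>\<infinity>k\<in>{k. k mod 10 = int j}. wave (2 powi k) p)"

section \<open>Chords and arcs of the unit circle\<close>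

lemma norm_cis_diff: "norm (cis a - cis b) = 2 * \<bar>sin ((a - b) / 2)\<bar>"
proof -
  have "cis a - cis b = cis b * (cis (a - b) - 1)"
    by (simp add: algebra_simps cis_mult)
  then show ?thesis
    using dist_exp_i_1[of "a - b"] by (simp add: norm_mult cis_conv_exp)
qed

lemma norm_cis_diff_le: "norm (cis a - cis b) \<le> \<bar>a - b\<bar>"
  unfolding norm_cis_diff using abs_sin_x_le_abs_x[of "(a - b) / 2"] by simp

text \<open>As \<open>1 < pi / 3\<close>, the cosine is at least \<open>1 / 2\<close> on the
  interval, so \<open>sin z - z / 2\<close> is nondecreasing.\<close>

lemma sin_ge_half:
  fixes z :: real
  assumes "0 \<le> z" "z \<le> 1"
  shows "z / 2 \<le> sin z"
proof -
  have "(\<lambda>z. sin z - z / 2) 0 \<le> (\<lambda>z. sin z - z / 2) z"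
  proof (rule DERIV_nonneg_imp_nondecreasing[OF assms(1)])
    fix u :: real assume u: "0 \<le> u" "u \<le> z"
    have "cos (pi / 3) \<le> cos u"
      using u assms pi_gt3 by (intro cos_monotone_0_pi_le) auto
    then have "cos u - 1 / 2 \<ge> 0" by (simp add: cos_60)
    moreover have "((\<lambda>z. sin z - z / 2) has_real_derivative (cos u - 1 / 2)) (at u)"
      by (auto intro!: derivative_eq_intros)
    ultimately show "\<exists>y. ((\<lambda>z. sin z - z / 2) has_real_derivative y) (at u) \<and> 0 \<le> y" by blast
  qed
  then show ?thesis by simp
qed

lemma norm_cis_diff_ge:
  assumes "\<bar>a - b\<bar> \<le> 1"
  shows "\<bar>a - b\<bar> / 2 \<le> norm (cis a - cis b)"
proof -
  define z where "z = \<bar>a - b\<bar> / 2"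
  have "(a - b) / 2 = z \<or> (a - b) / 2 = - z" by (auto simp: z_def abs_if field_simps)
  then have "\<bar>sin ((a - b) / 2)\<bar> = \<bar>sin z\<bar>" by auto
  moreover have "z / 2 \<le> sin z" using assms by (intro sin_ge_half) (auto simp: z_def)
  ultimately show ?thesis unfolding norm_cis_diff z_def by linarith
qed

section \<open>Variation of the cutoffs over all scales\<close>

lemma cutoff_bounds:
  assumes "q > 0"
  shows "0 \<le> cutoff q x" "cutoff q x \<le> 1 / q"
    "2 \<le> q * \<bar>x\<bar> \<Longrightarrow> cutoff q x = 0" "q * \<bar>x\<bar> \<le> 1 \<Longrightarrow> cutoff q x = 1 / q"
  using assms by (auto simp: cutoff_def field_simps max_def min_def)

text \<open>
  The \<open>k\<close>-th cutoff varies, with slope at most 1, only for \<open>\<bar>x\<bar>\<close> in the dyadic interval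
  \<open>[2 powi (-k), 2 powi (1 - k)]\<close>, and these intervals do not overlap.
\<close>
lemma sum_cutoff_diff_le:
  assumes "finite A"
  shows "(\<Sum>k\<in>A. \<bar>cutoff (2 powi k) x - cutoff (2 powi k) x'\<bar>) \<le> \<bar>x - x'\<bar>"
proof -
  have le: "(\<Sum>k\<in>A. \<bar>cutoff (2 powi k) x - cutoff (2 powi k) x'\<bar>) \<le> \<bar>x'\<bar> - \<bar>x\<bar>"
    if uv: "\<bar>x\<bar> \<le> \<bar>x'\<bar>" for x x' :: real
  proof -
    define u v where "u = \<bar>x\<bar>" and "v = \<bar>x'\<bar>"
    \<comment> \<open>\<open>cl l h\<close> clamps to \<open>[l, h]\<close>. Increments of clamps to
      adjacent intervals telescope into that of a single clamp, which is at most
      \<open>v - u\<close>.\<close>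
    define cl where "cl l h t = max l (min h t)" for l h t :: real
    have cl_add: "cl l m v - cl l m u + (cl m h v - cl m h u) = cl l h v - cl l h u"
      if "l \<le> m" "m \<le> h" for l m h
      using that by (auto simp: cl_def max_def min_def)
    have cl_le: "cl l h v - cl l h u \<le> v - u" for l h
      using uv by (auto simp: cl_def max_def min_def u_def v_def)
    have diff: "\<bar>cutoff (2 powi k) x - cutoff (2 powi k) x'\<bar>
        = cl (2 powi (-k)) (2 powi (1 - k)) v - cl (2 powi (-k)) (2 powi (1 - k)) u" for k
    proof -
      have e: "2 powi (1 - k) = 2 / (2 powi k :: real)" "2 powi (-k) = 1 / (2 powi k :: real)"
        by (simp_all add: power_int_diff power_int_minus_divide)
      have "cl l h u \<le> cl l h v" for l h
        using uv by (auto simp: cl_def max_def min_def u_def v_def)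
      then show ?thesis unfolding e cutoff_def by (simp add: cl_def u_def v_def)
    qed
    have tele: "(\<Sum>k\<in>{m..<m + int n}. \<bar>cutoff (2 powi k) x - cutoff (2 powi k) x'\<bar>)
        = cl (2 powi (1 - m - int n)) (2 powi (1 - m)) v - cl (2 powi (1 - m - int n)) (2 powi (1 - m)) u" for m n
    proof (induction n)
      case 0
      show ?case by (auto simp: cl_def max_def min_def)
    next
      case (Suc n)
      have "{m..<m + int (Suc n)} = insert (m + int n) {m..<m + int n}" by auto
      then have "(\<Sum>k\<in>{m..<m + int (Suc n)}. \<bar>cutoff (2 powi k) x - cutoff (2 powi k) x'\<bar>)
        = (cl (2 powi (-m - int n)) (2 powi (1 - m - int n)) v - cl (2 powi (-m - int n)) (2 powi (1 - m - int n)) u)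
        + (cl (2 powi (1 - m - int n)) (2 powi (1 - m)) v - cl (2 powi (1 - m - int n)) (2 powi (1 - m)) u)"
        using diff[of "m + int n"] Suc by (simp add: algebra_simps)
      also have "\<dots> = cl (2 powi (-m - int n)) (2 powi (1 - m)) v - cl (2 powi (-m - int n)) (2 powi (1 - m)) u"
        by (rule cl_add) (auto intro!: power_int_increasing)
      finally show ?case by (simp add: algebra_simps)
    qed
    \<comment> \<open>If \<open>A\<close> is empty, \<open>M\<close> is arbitrary and may be
      negative, hence \<open>\<bar>M\<bar>\<close> in the range below.\<close>
    obtain M where M: "\<And>k. k \<in> A \<Longrightarrow> \<bar>k\<bar> \<le> M"
      using assms finite_imageI[of A abs] by (meson Max_ge imageI)
    define n where "n = nat (2 * \<bar>M\<bar> + 1)"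
    have "A \<subseteq> {- \<bar>M\<bar>..<- \<bar>M\<bar> + int n}" using M by (fastforce simp: n_def abs_le_iff)
    then have "(\<Sum>k\<in>A. \<bar>cutoff (2 powi k) x - cutoff (2 powi k) x'\<bar>)
        \<le> (\<Sum>k\<in>{- \<bar>M\<bar>..<- \<bar>M\<bar> + int n}. \<bar>cutoff (2 powi k) x - cutoff (2 powi k) x'\<bar>)"
      by (intro sum_mono2) auto
    also have "\<dots> \<le> v - u" unfolding tele by (rule cl_le)
    finally show ?thesis by (simp add: u_def v_def)
  qed
  show ?thesis
  proof (cases "\<bar>x\<bar> \<le> \<bar>x'\<bar>")
    case True
    from le[OF True] show ?thesis by linarith
  next
    case False
    then have "(\<Sum>k\<in>A. \<bar>cutoff (2 powi k) x' - cutoff (2 powi k) x\<bar>) \<le> \<bar>x\<bar> - \<bar>x'\<bar>"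
      by (intro le) auto
    then show ?thesis by (simp add: abs_minus_commute)
  qed
qed

section \<open>Geometric sums\<close>

lemma sum_half_power_le:
  fixes B :: "nat set"
  assumes "finite B" "\<And>n. n \<in> B \<Longrightarrow> N \<le> n"
  shows "(\<Sum>n\<in>B. (1 / 2) ^ n) \<le> (2 * (1 / 2) ^ N :: real)"
proof -
  have eq: "(\<Sum>n\<in>{N..<N + d}. (1 / 2) ^ n) = (2 * (1 / 2) ^ N - 2 * (1 / 2) ^ (N + d) :: real)" for d
    by (induction d) simp_all
  obtain M where "\<And>n. n \<in> B \<Longrightarrow> n \<le> M" using assms(1) Max_ge by blast
  then have "B \<subseteq> {N..<N + (M + 1)}" using assms(2) by fastforce
  then have "(\<Sum>n\<in>B. (1 / 2) ^ n) \<le> (\<Sum>n\<in>{N..<N + (M + 1)}. (1 / 2) ^ n :: real)"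
    by (intro sum_mono2) auto
  also have "\<dots> \<le> 2 * (1 / 2) ^ N" unfolding eq by simp
  finally show ?thesis .
qed

lemma sum_half_power_int_le:
  fixes A :: "int set"
  assumes A: "finite A" and N: "\<And>k. k \<in> A \<Longrightarrow> int N \<le> \<bar>k - m\<bar>"
  shows "(\<Sum>k\<in>A. (1 / 2) ^ nat \<bar>k - m\<bar>) \<le> (4 * (1 / 2) ^ N :: real)"
proof -
  have part: "(\<Sum>k\<in>A'. (1 / 2) ^ nat \<bar>k - m\<bar>) \<le> (2 * (1 / 2) ^ N :: real)"
    if "A' \<subseteq> A" and inj: "inj_on (\<lambda>k. nat \<bar>k - m\<bar>) A'" for A'
  proof -
    have "(\<Sum>k\<in>A'. (1 / 2) ^ nat \<bar>k - m\<bar>) = (\<Sum>n\<in>(\<lambda>k. nat \<bar>k - m\<bar>) ` A'. (1 / 2) ^ n :: real)"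
      by (simp add: sum.reindex[OF inj])
    also have "\<dots> \<le> 2 * (1 / 2) ^ N"
      by (rule sum_half_power_le) (use that A N finite_subset in \<open>fastforce+\<close>)
    finally show ?thesis .
  qed
  have "A = {k\<in>A. k \<ge> m} \<union> {k\<in>A. k < m}" by auto
  then have "(\<Sum>k\<in>A. (1 / 2) ^ nat \<bar>k - m\<bar>)
      = (\<Sum>k\<in>{k\<in>A. k \<ge> m}. (1 / 2) ^ nat \<bar>k - m\<bar>) + (\<Sum>k\<in>{k\<in>A. k < m}. (1 / 2) ^ nat \<bar>k - m\<bar> :: real)"
    using A by (subst sum.union_disjoint[symmetric]) auto
  also have "\<dots> \<le> 2 * (1 / 2) ^ N + 2 * (1 / 2) ^ N"
    by (intro add_mono part) (auto simp: inj_on_def)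
  finally show ?thesis by simp
qed

section \<open>Vertical increments of a single wave\<close>

lemma norm_wave_diff:
  assumes "q > 0"
  shows "norm (wave q (x, y1) - wave q (x, y2)) = cutoff q x * norm (cis (q\<^sup>2 * y1) - cis (q\<^sup>2 * y2))"
proof -
  have "wave q (x, y1) - wave q (x, y2) = complex_of_real (cutoff q x) * (cis (q\<^sup>2 * y1) - cis (q\<^sup>2 * y2))"
    by (simp add: wave_def algebra_simps)
  then show ?thesis using cutoff_bounds(1)[OF assms] by (simp add: norm_mult)
qed

text \<open>The first bound comes from the phase and serves coarse scales, the second from the
  amplitude and serves fine ones, the third from the cutoff.\<close>

lemma norm_wave_diff_le:
  assumes "q > 0"
  shows "norm (wave q (x, y1) - wave q (x, y2)) \<le> q * \<bar>y1 - y2\<bar>"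
    and "norm (wave q (x, y1) - wave q (x, y2)) \<le> 2 / q"
    and "2 \<le> q * \<bar>x\<bar> \<Longrightarrow> norm (wave q (x, y1) - wave q (x, y2)) = 0"
proof -
  note c = cutoff_bounds[OF assms, of x]
  have "norm (cis (q\<^sup>2 * y1) - cis (q\<^sup>2 * y2)) \<le> q\<^sup>2 * \<bar>y1 - y2\<bar>"
    using norm_cis_diff_le[of "q\<^sup>2 * y1" "q\<^sup>2 * y2"] by (simp add: abs_mult flip: right_diff_distrib)
  then have "norm (wave q (x, y1) - wave q (x, y2)) \<le> 1 / q * (q\<^sup>2 * \<bar>y1 - y2\<bar>)"
    unfolding norm_wave_diff[OF assms] using assms c by (intro mult_mono) auto
  then show "norm (wave q (x, y1) - wave q (x, y2)) \<le> q * \<bar>y1 - y2\<bar>"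
    using assms by (simp add: power2_eq_square)
  have "norm (cis (q\<^sup>2 * y1) - cis (q\<^sup>2 * y2)) \<le> 2"
    using norm_triangle_ineq4[of "cis (q\<^sup>2 * y1)" "cis (q\<^sup>2 * y2)"] by simp
  then have "norm (wave q (x, y1) - wave q (x, y2)) \<le> 1 / q * 2"
    unfolding norm_wave_diff[OF assms] using assms c by (intro mult_mono) auto
  then show "norm (wave q (x, y1) - wave q (x, y2)) \<le> 2 / q" by simp
  show "norm (wave q (x, y1) - wave q (x, y2)) = 0" if "2 \<le> q * \<bar>x\<bar>"
    unfolding norm_wave_diff[OF assms] using c(3)[OF that] by simp
qed

lemma ex_dyadic_scale:
  fixes w :: real
  assumes "w > 0"
  obtains m :: int where "2 powi m * w \<le> 1" "1 < 2 * (2 powi m) * w"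
proof -
  define m where "m = \<lfloor>log 2 (1 / w)\<rfloor>"
  have "2 powr m \<le> 1 / w \<and> 1 / w < 2 powr (m + 1)"
    using assms by (subst floor_log_eq_powr_iff[symmetric]) (auto simp: m_def)
  moreover have "(2::real) powr m = 2 powi m" by (simp add: powr_real_of_int')
  moreover have "(2::real) powr (m + 1) = 2 * 2 powi m"
    by (simp add: powr_add powr_real_of_int')
  ultimately show thesis using assms by (intro that[of m]) (auto simp: field_simps)
qed

text \<open>
  The scale \<open>2 powi m\<close> sees the vertical displacement \<open>y1 - y2\<close>; the contributions of all other
  scales decay geometrically with their distance to it.
\<close>
lemma wave_scale:
  assumes "y1 \<noteq> y2"
  obtains m :: int where
    "\<And>k. norm (wave (2 powi k) (x, y1) - wave (2 powi k) (x, y2)) \<le> 16 * vert x (y1 - y2) * (1 / 2) ^ nat \<bar>k - m\<bar>"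
    "vert x (y1 - y2) / 4 \<le> norm (wave (2 powi m) (x, y1) - wave (2 powi m) (x, y2))"
proof -
  define s where "s = sqrt \<bar>y1 - y2\<bar>"
  define w where "w = \<bar>x\<bar> + s"
  define D where "D = vert x (y1 - y2)"
  have s: "s > 0" "\<bar>y1 - y2\<bar> = s * s" using assms by (auto simp: s_def)
  have w: "w > 0" "s \<le> w" "\<bar>x\<bar> \<le> w" using s by (auto simp: w_def)
  have D: "D = s * s / w" unfolding D_def vert_def by (simp add: s_def w_def)
  have D0: "D \<ge> 0" by (simp add: D_def vert_nonneg)
  obtain m :: int where m: "2 powi m * w \<le> 1" "1 < 2 * (2 powi m) * w"
    using ex_dyadic_scale[OF w(1)] .
  define Q :: real where "Q = 2 powi m"
  have Q: "Q > 0" "Q * w \<le> 1" "1 < 2 * Q * w" using m by (auto simp: Q_def)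
  \<comment> \<open>Since \<open>Q * w\<close> lies between \<open>1 / 2\<close> and 1, the phase
    bound \<open>Q * (s * s)\<close> at scale \<open>m\<close> is comparable to
    \<open>D = s * s / w\<close>.\<close>
  have QD: "Q * (s * s) \<le> D"
  proof -
    have "(Q * w) * (s * s) \<le> 1 * (s * s)" using Q by (intro mult_right_mono) auto
    then show ?thesis unfolding D using w by (simp add: pos_le_divide_eq mult_ac)
  qed
  show thesis
  proof (rule that[of m])
    fix k :: int
    define n where "n = nat \<bar>k - m\<bar>"
    define q :: real where "q = 2 powi k"
    have q0: "q > 0" by (simp add: q_def)
    note nb = norm_wave_diff_le[OF q0, of x y1 y2]
    show "norm (wave (2 powi k) (x, y1) - wave (2 powi k) (x, y2)) \<le> 16 * vert x (y1 - y2) * (1 / 2) ^ nat \<bar>k - m\<bar>"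
      unfolding D_def[symmetric] n_def[symmetric] q_def[symmetric]
    proof (cases "k \<le> m")
      case True
      then have "k = m - int n" by (simp add: n_def)
      then have q: "q = Q * (1 / 2) ^ n"
        by (simp add: q_def Q_def power_int_diff power_one_over)
      have "norm (wave q (x, y1) - wave q (x, y2)) \<le> q * (s * s)" using nb(1) s(2) by simp
      also have "\<dots> = (Q * (s * s)) * (1 / 2) ^ n" by (simp add: q)
      also have "\<dots> \<le> (16 * D) * (1 / 2) ^ n"
        by (rule mult_right_mono) (use QD D0 in auto)
      finally show "norm (wave q (x, y1) - wave q (x, y2)) \<le> 16 * D * (1 / 2) ^ n" .
    next
      case False
      then have "k = m + int n" by (simp add: n_def)
      then have q: "q = Q * 2 ^ n" by (simp add: q_def Q_def power_int_add)
      show "norm (wave q (x, y1) - wave q (x, y2)) \<le> 16 * D * (1 / 2) ^ n"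
      \<comment> \<open>Near the axis \<open>w \<le> 2 * s\<close>, so \<open>D\<close> is at least
        \<open>w / 4\<close> and the decaying amplitude is enough. Away from it the cutoff removes
        all scales from the third finer one on.\<close>
      proof (cases "\<bar>x\<bar> \<le> s")
        case True
        have "w * w \<le> (2 * s) * (2 * s)" using True w by (intro mult_mono) (auto simp: w_def)
        then have wD: "w \<le> 4 * D" unfolding D using w by (simp add: field_simps)
        have "1 / Q < 2 * w" using Q by (simp add: field_simps)
        have "2 / q = 2 * (1 / Q) * (1 / 2) ^ n" by (simp add: q power_one_over)
        also have "\<dots> \<le> (16 * D) * (1 / 2) ^ n"
          using wD \<open>1 / Q < 2 * w\<close> by (intro mult_right_mono) auto
        finally show ?thesis using nb(2) by linarith
      next
        case xs: False
        show ?thesis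
        proof (cases "n \<ge> 3")
          case True
          have "2 \<le> q * \<bar>x\<bar>"
          proof -
            have "(2::real) ^ 3 \<le> 2 ^ n" using True by (intro power_increasing) auto
            then have "8 \<le> (2::real) ^ n" by simp
            then have "Q * 8 * \<bar>x\<bar> \<le> q * \<bar>x\<bar>"
              unfolding q using Q by (intro mult_right_mono mult_left_mono) auto
            moreover have "Q * w \<le> Q * (2 * \<bar>x\<bar>)" using xs Q by (intro mult_left_mono) (auto simp: w_def)
            ultimately show ?thesis using Q(3) by linarith
          qed
          then show ?thesis using nb(3) D0 by simp
        next
          case False
          then have "n \<in> {0, 1, 2}" by auto
          \<comment> \<open>Equality at \<open>n = 2\<close> is what requires the constant
            16.\<close>
          then have n4: "(2::real) ^ n \<le> 16 * (1 / 2) ^ n" by (auto simp: power2_eq_square)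
          have "norm (wave q (x, y1) - wave q (x, y2)) \<le> q * (s * s)" using nb(1) s(2) by simp
          also have "\<dots> = (Q * (s * s)) * 2 ^ n" by (simp add: q)
          also have "\<dots> \<le> D * (16 * (1 / 2) ^ n)"
            using QD D0 n4 by (intro mult_mono) auto
          finally show ?thesis by simp
        qed
      qed
    qed
  next
    \<comment> \<open>Both \<open>\<bar>x\<bar>\<close> and \<open>s\<close> are at most
      \<open>w\<close>, so at scale \<open>Q\<close> the cutoff is on its plateau and the phase
      difference \<open>(Q * s)\<^sup>2\<close> is at most 1.\<close>
    have le1: "Q * z \<le> 1" if "z \<le> w" for z
      using mult_left_mono[OF that, of Q] Q by linarith
    have c: "cutoff Q x = 1 / Q" using Q(1) le1[OF w(3)] by (rule cutoff_bounds)
    have "(Q * s) * (Q * s) \<le> 1 * 1" using Q s le1[OF w(2)] by (intro mult_mono) auto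
    moreover have arg: "\<bar>Q\<^sup>2 * y1 - Q\<^sup>2 * y2\<bar> = (Q * s) * (Q * s)"
      using s(2) by (simp add: abs_mult power2_eq_square flip: right_diff_distrib)
    ultimately have "(Q * s) * (Q * s) / 2 \<le> norm (cis (Q\<^sup>2 * y1) - cis (Q\<^sup>2 * y2))"
      using norm_cis_diff_ge[of "Q\<^sup>2 * y1" "Q\<^sup>2 * y2"] by simp
    then have "1 / Q * ((Q * s) * (Q * s) / 2) \<le> norm (wave Q (x, y1) - wave Q (x, y2))"
      unfolding norm_wave_diff[OF Q(1)] c using Q by (intro mult_left_mono) auto
    moreover have "1 / Q * ((Q * s) * (Q * s) / 2) = Q * (s * s) / 2"
      using Q by simp
    moreover have "D \<le> 2 * (Q * (s * s))"
    proof -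
      have "s * s * 1 \<le> s * s * (2 * Q * w)" using Q s by (intro mult_left_mono) auto
      then show ?thesis unfolding D using w by (simp add: pos_divide_le_eq mult_ac)
    qed
    ultimately show "vert x (y1 - y2) / 4 \<le> norm (wave (2 powi m) (x, y1) - wave (2 powi m) (x, y2))"
      unfolding D_def[symmetric] Q_def[symmetric] by linarith
  qed
qed

section \<open>Convergence of the series and estimates for it\<close>

lemma infsum_norm_bound_finite_sums:
  fixes f :: "'i \<Rightarrow> 'a::banach"
  assumes "\<And>F. finite F \<Longrightarrow> F \<subseteq> A \<Longrightarrow> (\<Sum>k\<in>F. norm (f k)) \<le> b"
  shows "f summable_on A" and "norm (infsum f A) \<le> b"
proof -
  have abs: "f abs_summable_on A"
    unfolding abs_summable_iff_bdd_above by (rule bdd_aboveI2[of _ _ b]) (use assms in auto)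
  then show "f summable_on A" by (rule abs_summable_summable)
  have "norm (infsum f A) \<le> infsum (\<lambda>k. norm (f k)) A" by (rule norm_infsum_bound[OF abs])
  also have "\<dots> \<le> b" by (rule infsum_le_finite_sums[OF abs assms])
  finally show "norm (infsum f A) \<le> b" .
qed

text \<open>The passage from \<open>p\<close> to \<open>q\<close> is first horizontal at height
  \<open>y1\<close>, controlled by the variation of the cutoffs, then vertical at abscissa
  \<open>x2\<close>, where the geometric decay in \<open>wave_scale\<close> sums to
  \<open>16 * 4 = 64\<close> times \<open>vert\<close>.\<close>

lemma sum_wave_diff_le:
  assumes "finite A"
  shows "(\<Sum>k\<in>A. norm (wave (2 powi k) p - wave (2 powi k) q)) \<le> 64 * grushin_gauge p q"
proof -
  obtain x1 y1 x2 y2 where pq: "p = (x1, y1)" "q = (x2, y2)" by (cases p; cases q)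
  have hor: "norm (wave r (x1, y1) - wave r (x2, y1)) \<le> 2 * \<bar>cutoff r x1 - cutoff r x2\<bar>" for r
  proof -
    have "wave r (x1, y1) - wave r (x2, y1)
        = complex_of_real (cutoff r x1 - cutoff r x2) * (cis (r\<^sup>2 * y1) - 1)"
      by (simp add: wave_def algebra_simps)
    then have "norm (wave r (x1, y1) - wave r (x2, y1)) = \<bar>cutoff r x1 - cutoff r x2\<bar> * norm (cis (r\<^sup>2 * y1) - 1)"
      by (simp only: norm_mult norm_of_real)
    also have "\<dots> \<le> \<bar>cutoff r x1 - cutoff r x2\<bar> * 2"
      using norm_triangle_ineq4[of "cis (r\<^sup>2 * y1)" 1] by (intro mult_left_mono) auto
    finally show ?thesis by simp
  qed
  have ver: "(\<Sum>k\<in>A. norm (wave (2 powi k) (x2, y1) - wave (2 powi k) (x2, y2))) \<le> 64 * vert x2 (y1 - y2)"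
  proof (cases "y1 = y2")
    case False
    from wave_scale[OF this, of x2] obtain m :: int where m:
      "\<And>k. norm (wave (2 powi k) (x2, y1) - wave (2 powi k) (x2, y2)) \<le> 16 * vert x2 (y1 - y2) * (1 / 2) ^ nat \<bar>k - m\<bar>"
      by metis
    have "(\<Sum>k\<in>A. norm (wave (2 powi k) (x2, y1) - wave (2 powi k) (x2, y2)))
        \<le> 16 * vert x2 (y1 - y2) * (\<Sum>k\<in>A. (1 / 2) ^ nat \<bar>k - m\<bar>)"
      unfolding sum_distrib_left by (rule sum_mono) (rule m)
    also have "\<dots> \<le> 16 * vert x2 (y1 - y2) * 4"
      using sum_half_power_int_le[OF assms, of 0 m] vert_nonneg[of x2 "y1 - y2"] by (intro mult_left_mono) auto
    finally show ?thesis by simp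
  qed (simp add: vert_nonneg)
  have "(\<Sum>k\<in>A. norm (wave (2 powi k) p - wave (2 powi k) q))
      \<le> (\<Sum>k\<in>A. 2 * \<bar>cutoff (2 powi k) x1 - cutoff (2 powi k) x2\<bar>
          + norm (wave (2 powi k) (x2, y1) - wave (2 powi k) (x2, y2)))"
  proof (rule sum_mono)
    fix k
    show "norm (wave (2 powi k) p - wave (2 powi k) q) \<le> 2 * \<bar>cutoff (2 powi k) x1 - cutoff (2 powi k) x2\<bar>
          + norm (wave (2 powi k) (x2, y1) - wave (2 powi k) (x2, y2))"
      unfolding pq using hor[of "2 powi k"]
      norm_triangle_ineq[of "wave (2 powi k) (x1, y1) - wave (2 powi k) (x2, y1)" "wave (2 powi k) (x2, y1) - wave (2 powi k) (x2, y2)"]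
      by simp
  qed
  also have "\<dots> \<le> 2 * \<bar>x1 - x2\<bar> + 64 * vert x2 (y1 - y2)"
    unfolding sum.distrib sum_distrib_left[symmetric]
    by (intro add_mono mult_left_mono sum_cutoff_diff_le[OF assms] ver) simp
  also have "\<dots> \<le> 64 * grushin_gauge p q" by (simp add: grushin_gauge_def pq)
  finally show ?thesis .
qed

lemma wave_summable: "(\<lambda>k. wave (2 powi k) p) summable_on A"
  by (rule infsum_norm_bound_finite_sums(1)[where b = "64 * grushin_gauge p (0, 0)"])
    (use sum_wave_diff_le[of _ p "(0, 0)"] in \<open>simp add: wave_def\<close>)

lemma wave_sum_diff:
  "wave_sum j p - wave_sum j q = (\<Sum>\<^sub>\<infinity>k\<in>{k. k mod 10 = int j}. wave (2 powi k) p - wave (2 powi k) q)"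
  unfolding wave_sum_def
  unfolding diff_conv_add_uminus
  by (rule infsumI[symmetric], rule has_sum_add)
    (simp_all add: has_sum_uminus has_sum_infsum wave_summable)

lemma norm_wave_sum_diff_le: "norm (wave_sum j p - wave_sum j q) \<le> 64 * grushin_gauge p q"
  unfolding wave_sum_diff by (rule infsum_norm_bound_finite_sums) (rule sum_wave_diff_le)

text \<open>In the residue class of the dominant scale all other scales are at least 10 steps away
  and contribute at most \<open>16 * 4 / 2 ^ 10 = 1 / 16\<close> of \<open>D\<close>, against at
  least \<open>1 / 4\<close> from the dominant one.\<close>

lemma wave_sum_detects_vertical:
  "\<exists>j<10. 3 / 16 * vert x (y1 - y2) \<le> norm (wave_sum j (x, y1) - wave_sum j (x, y2))"
proof (cases "y1 = y2")
  case True
  then show ?thesis by (auto simp: vert_def intro: exI[of _ 0])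
next
  case False
  define D where "D = vert x (y1 - y2)"
  define g where "g k = wave (2 powi k) (x, y1) - wave (2 powi k) (x, y2)" for k
  obtain m :: int where m: "\<And>k. norm (g k) \<le> 16 * D * (1 / 2) ^ nat \<bar>k - m\<bar>" "D / 4 \<le> norm (g m)"
    using wave_scale[OF False, of x] unfolding g_def D_def by metis
  have D0: "D \<ge> 0" by (simp add: D_def vert_nonneg)
  define j where "j = nat (m mod 10)"
  have j: "j < 10" "int j = m mod 10" by (auto simp: j_def nat_less_iff)
  define A where "A = {k. k mod 10 = int j} - {m}"
  have tail: "(\<Sum>k\<in>F. norm (g k)) \<le> D / 16" if F: "finite F" "F \<subseteq> A" for F
  proof -
    have far: "int 10 \<le> \<bar>k - m\<bar>" if "k \<in> F" for k
    proof -
      have "k \<noteq> m" "k mod 10 = m mod 10" using that F j by (auto simp: A_def)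
      then have "10 dvd k - m" by (simp add: mod_eq_dvd_iff)
      then have "\<bar>10\<bar> \<le> \<bar>k - m\<bar>" using \<open>k \<noteq> m\<close> by (intro dvd_imp_le_int) auto
      then show ?thesis by simp
    qed
    have "(\<Sum>k\<in>F. norm (g k)) \<le> 16 * D * (\<Sum>k\<in>F. (1 / 2) ^ nat \<bar>k - m\<bar>)"
      unfolding sum_distrib_left by (rule sum_mono) (rule m)
    also have "\<dots> \<le> 16 * D * (4 * (1 / 2) ^ 10)"
      using D0 by (intro mult_left_mono sum_half_power_int_le[OF F(1) far]) auto
    finally show ?thesis by (simp add: power_one_over)
  qed
  have "wave_sum j (x, y1) - wave_sum j (x, y2) = infsum g (insert m A)"
    unfolding wave_sum_diff g_def using j by (auto simp: A_def intro!: arg_cong[of _ _ "infsum _"])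
  also have "\<dots> = g m + infsum g A"
    by (rule infsum_insert[OF infsum_norm_bound_finite_sums(1)[OF tail]]) (simp_all add: A_def)
  finally have "norm (g m) \<le> norm (wave_sum j (x, y1) - wave_sum j (x, y2)) + norm (infsum g A)"
    using norm_triangle_ineq4[of "g m + infsum g A" "infsum g A"] by simp
  moreover have "norm (infsum g A) \<le> D / 16"
    by (rule infsum_norm_bound_finite_sums(2)[OF tail])
  ultimately have "3 / 16 * D \<le> norm (wave_sum j (x, y1) - wave_sum j (x, y2))" using m(2) by linarith
  then show ?thesis using j(1) unfolding D_def by blast
qed

section \<open>The embedding\<close>

lemma eucl_dist_ge: "i < n \<Longrightarrow> \<bar>u i - v i\<bar> \<le> eucl_dist n u v"
  using member_le_L2_set[of "{..<n}" i "\<lambda>i. \<bar>u i - v i\<bar>"] by (simp add: eucl_dist_def L2_set_def)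

lemma eucl_dist_le:
  assumes "\<And>i. i < n \<Longrightarrow> \<bar>u i - v i\<bar> \<le> c"
  shows "eucl_dist n u v \<le> real n * c"
proof -
  have "eucl_dist n u v \<le> (\<Sum>i<n. \<bar>u i - v i\<bar>)"
    unfolding eucl_dist_def L2_set_def[symmetric] by (rule L2_set_le_sum_abs)
  also have "\<dots> \<le> (\<Sum>i<n. c)" by (rule sum_mono) (use assms in auto)
  finally show ?thesis by simp
qed

definition embedding :: "real \<times> real \<Rightarrow> nat \<Rightarrow> real" where
  "embedding p i = (if i < 10 then Re (wave_sum i p) else if i < 20 then Im (wave_sum (i - 10) p) else fst p)"

lemma embedding_le: "eucl_dist 21 (embedding p) (embedding q) \<le> 1344 * grushin_gauge p q"
proof -
  have "\<bar>embedding p i - embedding q i\<bar> \<le> 64 * grushin_gauge p q" for i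
  proof -
    have "\<bar>fst p - fst q\<bar> \<le> 64 * grushin_gauge p q"
      using vert_nonneg[of "fst q" "snd p - snd q"] by (simp add: grushin_gauge_def)
    then show ?thesis
      using order_trans[OF abs_Re_le_cmod norm_wave_sum_diff_le, of i p q]
        order_trans[OF abs_Im_le_cmod norm_wave_sum_diff_le, of "i - 10" p q]
      by (simp add: embedding_def)
  qed
  then show ?thesis using eucl_dist_le[of 21 "embedding p" "embedding q" "64 * grushin_gauge p q"] by simp
qed

text \<open>Vertical detection needs equal abscissae, so \<open>p\<close> is first moved to
  \<open>(x2, y1)\<close>. This costs at most \<open>64 * \<bar>x1 - x2\<bar>\<close>, which the
  last coordinate controls; in total \<open>16 / 3 * 66 + 1 = 353\<close>.\<close>

lemma grushin_gauge_le_embedding: "grushin_gauge p q \<le> 353 * eucl_dist 21 (embedding p) (embedding q)"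
proof -
  define E where "E = eucl_dist 21 (embedding p) (embedding q)"
  obtain x1 y1 x2 y2 where pq: "p = (x1, y1)" "q = (x2, y2)" by (cases p; cases q)
  have coord: "\<bar>embedding p i - embedding q i\<bar> \<le> E" if "i < 21" for i
    unfolding E_def using that by (rule eucl_dist_ge)
  have dx: "\<bar>x1 - x2\<bar> \<le> E" using coord[of 20] by (simp add: embedding_def pq)
  obtain j where j: "j < 10" "3 / 16 * vert x2 (y1 - y2) \<le> norm (wave_sum j (x2, y1) - wave_sum j q)"
    using wave_sum_detects_vertical[of x2 y1 y2] pq by auto
  have "norm (wave_sum j p - wave_sum j q) \<le> \<bar>Re (wave_sum j p - wave_sum j q)\<bar> + \<bar>Im (wave_sum j p - wave_sum j q)\<bar>"
    by (rule cmod_le)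
  also have "\<dots> \<le> 2 * E"
    using coord[of j] coord[of "j + 10"] j(1) by (simp add: embedding_def)
  finally have 1: "norm (wave_sum j p - wave_sum j q) \<le> 2 * E" .
  have "norm (wave_sum j (x2, y1) - wave_sum j p) \<le> 64 * \<bar>x1 - x2\<bar>"
    using norm_wave_sum_diff_le[of j p "(x2, y1)"] by (simp add: grushin_gauge_def vert_def pq norm_minus_commute)
  then have "norm (wave_sum j (x2, y1) - wave_sum j q) \<le> 66 * E"
    using 1 dx norm_triangle_ineq[of "wave_sum j (x2, y1) - wave_sum j p" "wave_sum j p - wave_sum j q"] by simp
  then show ?thesis
    using j(2) dx unfolding E_def[symmetric] by (simp add: grushin_gauge_def pq)
qed

theorem theorem4p7:
  shows "\<exists>(n::nat) (f :: real \<times> real \<Rightarrow> nat \<Rightarrow> real) (L::real). L > 0 \<and>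
           (\<forall>p q. ennreal (eucl_dist n (f p) (f q)) \<le> ennreal L * d_cc p q \<and>
                  d_cc p q \<le> ennreal L * ennreal (eucl_dist n (f p) (f q)))"
proof (intro exI[of _ "21::nat"] exI[of _ embedding] exI[of _ "3177::real"] conjI allI)
  \<comment> \<open>The constant 3177 is \<open>9 * 353\<close> from the upper bound on
    \<open>d_cc\<close>; it exceeds \<open>2 * 1344 = 2688\<close>, which the other inequality
    needs.\<close>
  fix p q
  let ?E = "eucl_dist 21 (embedding p) (embedding q)"
  have "ennreal ?E \<le> ennreal (1344 * grushin_gauge p q)" by (rule ennreal_leI[OF embedding_le])
  also have "\<dots> = 1344 * ennreal (grushin_gauge p q)"
    using ennreal_mult'[of 1344 "grushin_gauge p q"] by simp
  also have "\<dots> \<le> 1344 * (2 * d_cc p q)" by (intro mult_left_mono grushin_gauge_le_d_cc) simp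
  also have "\<dots> = 2688 * d_cc p q" by (simp flip: mult.assoc)
  also have "\<dots> \<le> ennreal 3177 * d_cc p q" by (intro mult_right_mono) auto
  finally show "ennreal ?E \<le> ennreal 3177 * d_cc p q" .
  have "d_cc p q \<le> ennreal (9 * grushin_gauge p q)" by (rule d_cc_le_grushin_gauge)
  also have "\<dots> \<le> ennreal (3177 * ?E)" using grushin_gauge_le_embedding[of p q] by (intro ennreal_leI) simp
  also have "\<dots> = ennreal 3177 * ennreal ?E" by (rule ennreal_mult') simp
  finally show "d_cc p q \<le> ennreal 3177 * ennreal ?E" .
qed simp

end
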